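(* Let $n\ge 1$ and let $P_n$ be the path graph with $n$ vertices. Assuming that both players play optimally, and know this about each other, the probability that player $1$ (the player who moves first) wins $MS(P_n)$ is $$\frac12 \ \text{ when } n \text{ is even};\qquad \frac{2k}{4k+1}\ \text{ when } n=4k+1 \text{ for some integer } k;\qquad \frac{2k+2}{4k+3}\ \text{ when } n=4k+3 \text{ for some integer } k.$$ Further, the first guesses of player $1$ that achieve these maximum winning probabilities are exactly the following (a guess $m\in\{1,\dots,n\}$ divides the game into two ranges, of sizes $m-1$ and $n-m$; the two sizes below may occur in either order, and $k_1,k_2$ are nonnegative integers). 1. When $n=4k$ for some $k$: the numbers that divide the game into ranges of sizes $4k_1+1$ and $4k_2+2$, for any choice of $k_1,k_2$ with $k_1+k_2=k-1$. 2. When $n=4k+1$ for some $k$: all of player $1$'s choices are of equal strength (every guess is optimal). 3. When $n=4k+2$ for some $k$: the numbers that divide the game into ranges of sizes $4k_1+1$ and $4k_2$, for any choice of $k_1,k_2$ with $k_1+k_2=k$. 4. When $n=4k+3$ for some $k$: the numbers that divide the game into ranges of sizes $4k_1+1$ and $4k_2+1$, for any choice of $k_1,k_2$ with $k_1+k_2=k$.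
   Context: The misère tree search game $MS(T)$ is played by two players on a finite tree $T$. One vertex of $T$, chosen uniformly at random and unknown to both players, is poisoned. The players alternately guess a vertex of the current tree, player $1$ moving first. If a player guesses the poisoned vertex, that player loses (and the other wins). Otherwise the guessed vertex is deleted from the current tree, it is revealed which of the resulting connected components contains the poisoned vertex, and the game continues on that component with the other player to move. (In particular a player facing a one-vertex tree must guess it and loses.) On the path $P_n$ the vertices are identified with the integers $1,\dots,n$ in order, so after a safe guess $m$ the game continues on the range $\{1,\dots,m-1\}$ or $\{m+1,\dots,n\}$, whichever contains the poisoned number; conditionally on this, the poisoned number is uniform on the remaining range. *)

theory Defs
  imports "HOL-Probability.Probability_Mass_Function"
begin

text \<open>
  A graph is given by a vertex set and a symmetric set E of adjacent pairs.  During the game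
  the edges in force are those of E between vertices of the current tree, so a position
  is described by its vertex set alone.
\<close>

definition component :: "('a \<times> 'a) set \<Rightarrow> 'a set \<Rightarrow> 'a \<Rightarrow> 'a set" where
  "component E S p = {w \<in> S. (p, w) \<in> (E \<inter> S \<times> S)\<^sup>*}"

text \<open>
  A strategy sees the earlier rounds (current tree and guess of each, most recent first) and
  the current tree; it does not see the poisoned vertex.  The same type serves both players.
\<close>

type_synonym 'a strategy = "('a set \<times> 'a) list \<Rightarrow> 'a set \<Rightarrow> 'a"

definition legal :: "'a strategy \<Rightarrow> bool" where
  "legal \<sigma> \<longleftrightarrow> (\<forall>h C. C \<noteq> {} \<longrightarrow> \<sigma> h C \<in> C)"

text \<open>
  \<open>mover_wins E p \<sigma> \<tau> h C\<close>: with \<open>p\<close> poisoned and the game at the tree \<open>C\<close> after the rounds \<open>h\<close>,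
  the player about to move, playing \<open>\<sigma>\<close>, wins against \<open>\<tau>\<close>.  The conditions
  \<open>finite C\<close>, \<open>p \<in> C\<close> and \<open>\<sigma> h C \<in> C\<close> only serve termination; they always hold when
  legal strategies play on a finite tree containing the poisoned vertex.
\<close>

function mover_wins ::
  "('a \<times> 'a) set \<Rightarrow> 'a \<Rightarrow> 'a strategy \<Rightarrow> 'a strategy \<Rightarrow> ('a set \<times> 'a) list \<Rightarrow> 'a set \<Rightarrow> bool" where
  "mover_wins E p \<sigma> \<tau> h C =
     (if finite C \<and> p \<in> C \<and> \<sigma> h C \<in> C \<and> \<sigma> h C \<noteq> p
      then \<not> mover_wins E p \<tau> \<sigma> ((C, \<sigma> h C) # h) (component E (C - {\<sigma> h C}) p)
      else False)"
  by pat_completeness auto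
termination
  by (relation "Wellfounded.measure (\<lambda>(E, p, \<sigma>, \<tau>, h, C). card C)")
     (auto simp: component_def intro!: psubset_card_mono)

declare mover_wins.simps [simp del]

definition win_prob :: "'a set \<Rightarrow> ('a \<times> 'a) set \<Rightarrow> 'a strategy \<Rightarrow> 'a strategy \<Rightarrow> real" where
  "win_prob V E \<sigma> \<tau> = measure_pmf.prob (pmf_of_set V) {p. mover_wins E p \<sigma> \<tau> [] V}"

text \<open>
  Neither player can gain by deviating.  Exactly one player wins each play, so player 2
  maximises its winning probability by minimising that of player 1.
\<close>

definition optimal_play :: "'a set \<Rightarrow> ('a \<times> 'a) set \<Rightarrow> 'a strategy \<Rightarrow> 'a strategy \<Rightarrow> bool" where
  "optimal_play V E \<sigma> \<tau> \<longleftrightarrow> legal \<sigma> \<and> legal \<tau> \<and>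
     (\<forall>\<sigma>'. legal \<sigma>' \<longrightarrow> win_prob V E \<sigma>' \<tau> \<le> win_prob V E \<sigma> \<tau>) \<and>
     (\<forall>\<tau>'. legal \<tau>' \<longrightarrow> win_prob V E \<sigma> \<tau> \<le> win_prob V E \<sigma> \<tau>')"

definition optimal_first_guesses :: "'a set \<Rightarrow> ('a \<times> 'a) set \<Rightarrow> 'a set" where
  "optimal_first_guesses V E = {\<sigma> [] V | \<sigma> \<tau>. optimal_play V E \<sigma> \<tau>}"

definition path_verts :: "nat \<Rightarrow> nat set" where
  "path_verts n = {1..n}"

definition path_edges :: "nat \<Rightarrow> (nat \<times> nat) set" where
  "path_edges n = {(i, j). i \<in> path_verts n \<and> j \<in> path_verts n \<and> (j = i + 1 \<or> i = j + 1)}"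

definition splits_into :: "nat \<Rightarrow> nat \<Rightarrow> nat \<Rightarrow> nat \<Rightarrow> bool" where
  "splits_into n m a b \<longleftrightarrow> (m - 1 = a \<and> n - m = b) \<or> (m - 1 = b \<and> n - m = a)"

end

theory Submission
  imports Defs
begin

text \<open>
  A first guess splits the path into a left and a right range.  Neither strategy knows the
  poisoned vertex, so counting the poisoned vertices for which the mover wins turns the game into
  one with additive payoff: the mover survives the guess exactly when the poison lies in one of
  the two ranges, and then has the role of the second player there.  If \<open>W n\<close> denotes the best
  count on \<open>n\<close> vertices and \<open>L n = n - W n\<close> what is left for the opponent, then
  \<open>W n\<close> is the maximum of \<open>L a + L b\<close> over \<open>a + b = n - 1\<close>.

  With the closed form \<open>mover_value\<close> for \<open>W\<close>, the number \<open>L n\<close> is \<open>n / 2\<close> plus a correction,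
  which is \<open>0\<close>, \<open>1/2\<close>, \<open>0\<close>, \<open>-1/2\<close> for \<open>n\<close> congruent to \<open>0\<close>, \<open>1\<close>, \<open>2\<close>, \<open>3\<close>
  modulo \<open>4\<close>.  So only the residues of \<open>a\<close> and \<open>b\<close> decide whether a split attains the maximum
  (\<open>replier_values_le\<close> and the four \<open>optimal_split\<close> lemmas); a range of size \<open>1\<close> is always a
  best part, hence guessing the second vertex of a path is optimal whenever there is one.

  A strategy that attains the maximum at every interval guarantees at least \<open>W\<close> for the mover and
  concedes at most \<open>W\<close> to the mover, whatever the other player does (\<open>optimal_strategy_bounds\<close>).
  Two such strategies are therefore in equilibrium, and every equilibrium has value \<open>W n / n\<close>.
  A first guess that misses the maximum is refuted by an optimal second player, so
  it occurs in no equilibrium; a first guess that attains it can be completed to an optimal strategy.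
\<close>

section \<open>The recursion for the number of winning vertices\<close>

text \<open>
  The closed forms of \<open>W\<close> and \<open>L\<close>: under optimal play, the number of poisoned vertices of a path
  on \<open>n\<close> vertices for which the player to move wins, respectively loses.
\<close>

definition mover_value :: "nat \<Rightarrow> nat" where
  "mover_value n = (if n mod 4 = 3 then n div 2 + 1 else n div 2)"

definition replier_value :: "nat \<Rightarrow> nat" where
  "replier_value n = n - mover_value n"

lemma mover_value_le: "mover_value n \<le> n"
  by (cases "n = 0") (auto simp: mover_value_def)

lemma mover_value_add4: "mover_value (4 * q + r) = 2 * q + mover_value r"
proof -
  have "(4 * q + r) div 2 = 2 * q + r div 2"
    by simp
  then show ?thesis
    by (simp add: mover_value_def)
qed

lemma replier_value_add4: "replier_value (4 * q + r) = 2 * q + replier_value r"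
  using mover_value_le[of r] by (simp add: replier_value_def mover_value_add4)

lemma mover_value_even: "even n \<Longrightarrow> mover_value n = n div 2"
proof -
  assume "even n"
  moreover have "even (n mod 4) \<longleftrightarrow> even n"
    by (simp add: even_even_mod_4_iff[symmetric])
  ultimately have "n mod 4 \<noteq> 3"
    by (metis odd_numeral)
  then show ?thesis
    by (simp add: mover_value_def)
qed

text \<open>
  Both sides of the comparison grow by \<open>2\<close> whenever one of the sizes grows by \<open>4\<close>, so only the
  residues matter.
\<close>

lemma split_value_residues:
  "replier_value a + replier_value b =
     2 * (a div 4 + b div 4) + (replier_value (a mod 4) + replier_value (b mod 4))"
  "mover_value (Suc (a + b)) = 2 * (a div 4 + b div 4) + mover_value (Suc (a mod 4 + b mod 4))"
proof -
  have a: "4 * (a div 4) + a mod 4 = a" and b: "4 * (b div 4) + b mod 4 = b"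
    by simp_all
  show "replier_value a + replier_value b =
      2 * (a div 4 + b div 4) + (replier_value (a mod 4) + replier_value (b mod 4))"
    using replier_value_add4[of "a div 4" "a mod 4"] replier_value_add4[of "b div 4" "b mod 4"]
    unfolding a b by simp
  have add_blocks: "Suc (a + b) = 4 * (p + q) + Suc (i + j)"
    if "4 * p + i = a" "4 * q + j = b" for p q i j
    using that by auto
  have "Suc (a + b) = 4 * (a div 4 + b div 4) + Suc (a mod 4 + b mod 4)"
    using add_blocks[OF a b] .
  then show "mover_value (Suc (a + b)) =
      2 * (a div 4 + b div 4) + mover_value (Suc (a mod 4 + b mod 4))"
    using mover_value_add4 by metis
qed

lemma mod4_cases: "n mod 4 \<in> {0, 1, 2, 3}" for n :: nat
proof -
  have "r \<in> {0, 1, 2, 3}" if "r < 4" for r :: nat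
    using that by auto
  then show ?thesis
    by simp
qed

lemma Suc_add_mod4: "Suc (a + b) mod 4 = Suc (a mod 4 + b mod 4) mod 4"
  by (metis mod_Suc_eq mod_add_eq)

lemma replier_values_le:
  "replier_value a + replier_value b \<le> mover_value (Suc (a + b))"
proof -
  have "replier_value i + replier_value j \<le> mover_value (Suc (i + j))"
    if "i \<in> {0, 1, 2, 3}" "j \<in> {0, 1, 2, 3}" for i j
    using that by (elim insertE emptyE) (simp_all add: replier_value_def mover_value_def)
  from this[OF mod4_cases mod4_cases] show ?thesis
    unfolding split_value_residues[of a b] nat_add_left_cancel_le .
qed

lemma optimal_split_0:
  assumes "Suc (a + b) mod 4 = 0"
  shows "replier_value a + replier_value b = mover_value (Suc (a + b)) \<longleftrightarrow>
    a mod 4 = 1 \<and> b mod 4 = 2 \<or> a mod 4 = 2 \<and> b mod 4 = 1"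
proof -
  have "Suc (i + j) mod 4 = 0 \<longrightarrow>
      (replier_value i + replier_value j = mover_value (Suc (i + j)) \<longleftrightarrow>
    i = 1 \<and> j = 2 \<or> i = 2 \<and> j = 1)"
    if "i \<in> {0, 1, 2, 3}" "j \<in> {0, 1, 2, 3}" for i j
    using that by (elim insertE emptyE) (simp_all add: replier_value_def mover_value_def)
  from this[OF mod4_cases mod4_cases, of a b] show ?thesis
    using assms unfolding split_value_residues[of a b] add_left_cancel Suc_add_mod4[of a b]
    by (rule mp)
qed

lemma optimal_split_1:
  assumes "Suc (a + b) mod 4 = 1"
  shows "replier_value a + replier_value b = mover_value (Suc (a + b))"
proof -
  have "Suc (i + j) mod 4 = 1 \<longrightarrow>
      (replier_value i + replier_value j = mover_value (Suc (i + j)))"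
    if "i \<in> {0, 1, 2, 3}" "j \<in> {0, 1, 2, 3}" for i j
    using that by (elim insertE emptyE) (simp_all add: replier_value_def mover_value_def)
  from this[OF mod4_cases mod4_cases, of a b] show ?thesis
    using assms unfolding split_value_residues[of a b] add_left_cancel Suc_add_mod4[of a b]
    by (rule mp)
qed

lemma optimal_split_2:
  assumes "Suc (a + b) mod 4 = 2"
  shows "replier_value a + replier_value b = mover_value (Suc (a + b)) \<longleftrightarrow>
    a mod 4 = 1 \<and> b mod 4 = 0 \<or> a mod 4 = 0 \<and> b mod 4 = 1"
proof -
  have "Suc (i + j) mod 4 = 2 \<longrightarrow>
      (replier_value i + replier_value j = mover_value (Suc (i + j)) \<longleftrightarrow>
    i = 1 \<and> j = 0 \<or> i = 0 \<and> j = 1)"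
    if "i \<in> {0, 1, 2, 3}" "j \<in> {0, 1, 2, 3}" for i j
    using that by (elim insertE emptyE) (simp_all add: replier_value_def mover_value_def)
  from this[OF mod4_cases mod4_cases, of a b] show ?thesis
    using assms unfolding split_value_residues[of a b] add_left_cancel Suc_add_mod4[of a b]
    by (rule mp)
qed

lemma optimal_split_3:
  assumes "Suc (a + b) mod 4 = 3"
  shows "replier_value a + replier_value b = mover_value (Suc (a + b)) \<longleftrightarrow>
    a mod 4 = 1 \<and> b mod 4 = 1"
proof -
  have "Suc (i + j) mod 4 = 3 \<longrightarrow>
      (replier_value i + replier_value j = mover_value (Suc (i + j)) \<longleftrightarrow>
    i = 1 \<and> j = 1)"
    if "i \<in> {0, 1, 2, 3}" "j \<in> {0, 1, 2, 3}" for i j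
    using that by (elim insertE emptyE) (simp_all add: replier_value_def mover_value_def)
  from this[OF mod4_cases mod4_cases, of a b] show ?thesis
    using assms unfolding split_value_residues[of a b] add_left_cancel Suc_add_mod4[of a b]
    by (rule mp)
qed

text \<open>Once the residues are known, the total size forces \<open>k1 + k2 = k\<close>.\<close>

lemma residue_split_iff:
  fixes a b i j k :: nat
  assumes sum: "a + b = 4 * k + i + j" and "i < 4" "j < 4"
  shows "a mod 4 = i \<and> b mod 4 = j \<or> a mod 4 = j \<and> b mod 4 = i \<longleftrightarrow>
    (\<exists>k1 k2. k1 + k2 = k \<and>
       (a = 4 * k1 + i \<and> b = 4 * k2 + j \<or> a = 4 * k2 + j \<and> b = 4 * k1 + i))"
    (is "?residues \<longleftrightarrow> ?sizes")
proof
  assume ?sizes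
  moreover have "(4 * q + r) mod 4 = r" if "r < 4" for q r :: nat
    using that by simp
  ultimately show ?residues
    using assms(2,3) by metis
next
  obtain p q where a: "a = 4 * p + a mod 4" and b: "b = 4 * q + b mod 4"
    by (rule that[OF mult_div_mod_eq[symmetric] mult_div_mod_eq[symmetric]])
  have blocks: "p + q = k" if "a = 4 * p + i'" "b = 4 * q + j'" "i + j = i' + j'" for i' j'
    using that sum by linarith
  assume ?residues
  then show ?sizes
  proof
    assume "a mod 4 = i \<and> b mod 4 = j"
    then have "a = 4 * p + i" "b = 4 * q + j"
      using a b by metis+
    moreover from this have "p + q = k"
      by (rule blocks) (rule refl)
    ultimately show ?sizes
      by blast
  next
    assume "a mod 4 = j \<and> b mod 4 = i"
    then have "a = 4 * p + j" "b = 4 * q + i"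
      using a b by metis+
    moreover from this have "q + p = k"
      using blocks[of j i] by (simp add: add.commute)
    ultimately show ?sizes
      by blast
  qed
qed

lemma optimal_sizes_0:
  assumes sum: "Suc (a + b) = 4 * k"
  shows "replier_value a + replier_value b = mover_value (Suc (a + b)) \<longleftrightarrow>
    (\<exists>k1 k2. int k1 + int k2 = int k - 1 \<and>
       (a = 4 * k1 + 1 \<and> b = 4 * k2 + 2 \<or> a = 4 * k2 + 2 \<and> b = 4 * k1 + 1))"
proof -
  have "Suc (a + b) mod 4 = 0"
    unfolding sum by simp
  note split = optimal_split_0[OF this]
  have k: "k \<ge> 1"
    using sum by (cases k) auto
  have int: "int k1 + int k2 = int k - 1 \<longleftrightarrow> k1 + k2 = k - 1" for k1 k2
    using k by linarith
  show ?thesis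
    unfolding split int by (rule residue_split_iff) (use sum k in linarith)+
qed

lemma optimal_sizes_1:
  assumes sum: "Suc (a + b) = 4 * k + 1"
  shows "replier_value a + replier_value b = mover_value (Suc (a + b))"
proof (rule optimal_split_1)
  show "Suc (a + b) mod 4 = 1"
    unfolding sum by simp
qed

lemma optimal_sizes_2:
  assumes sum: "Suc (a + b) = 4 * k + 2"
  shows "replier_value a + replier_value b = mover_value (Suc (a + b)) \<longleftrightarrow>
    (\<exists>k1 k2. k1 + k2 = k \<and>
       (a = 4 * k1 + 1 \<and> b = 4 * k2 \<or> a = 4 * k2 \<and> b = 4 * k1 + 1))"
proof -
  have "Suc (a + b) mod 4 = 2"
    unfolding sum by (subst mod_mult_self4) simp
  note split = optimal_split_2[OF this]
  show ?thesis
    unfolding split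
    by (rule residue_split_iff[of a b k 1 0, unfolded add_0_right]) (use sum in linarith)+
qed

lemma optimal_sizes_3:
  assumes sum: "Suc (a + b) = 4 * k + 3"
  shows "replier_value a + replier_value b = mover_value (Suc (a + b)) \<longleftrightarrow>
    (\<exists>k1 k2. k1 + k2 = k \<and>
       (a = 4 * k1 + 1 \<and> b = 4 * k2 + 1 \<or> a = 4 * k2 + 1 \<and> b = 4 * k1 + 1))"
proof -
  have "Suc (a + b) mod 4 = 3"
    unfolding sum by simp
  note split = optimal_split_3[OF this]
  show ?thesis
    unfolding split
    by (rule residue_split_iff[of a b k 1 1, unfolded disj_absorb]) (use sum in linarith)+
qed

text \<open>
  Positions are written as half-open intervals \<open>{l..<r}\<close>, so that the ranges \<open>{l..<m}\<close> and
  \<open>{Suc m..<r}\<close> left by a guess \<open>m\<close> at an end of the path need no special case.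
\<close>

definition optimal_guess :: "nat \<Rightarrow> nat \<Rightarrow> nat \<Rightarrow> bool" where
  "optimal_guess l r m \<longleftrightarrow> l \<le> m \<and> m < r \<and>
     replier_value (m - l) + replier_value (r - Suc m) = mover_value (r - l)"

lemma guess_value_le:
  assumes "l \<le> m" "m < r"
  shows "replier_value (m - l) + replier_value (r - Suc m) \<le> mover_value (r - l)"
proof -
  have "r - l = Suc ((m - l) + (r - Suc m))"
    using assms by simp
  then show ?thesis
    using replier_values_le by metis
qed

section \<open>Winning counts on intervals of a path\<close>

text \<open>
  Deleting a guess from an interval leaves a set \<open>S\<close> in which each of the two ranges is
  separated by a gap from the rest, which is all that the hypotheses say.
\<close>

lemma component_of_interval:
  assumes S: "S \<subseteq> path_verts n" and sub: "{a..<b} \<subseteq> S" and p: "p \<in> {a..<b}"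
    and left: "\<And>x. x \<in> S \<Longrightarrow> x < a \<Longrightarrow> Suc x < a"
    and right: "b \<notin> S"
  shows "component (path_edges n) S p = {a..<b}"
proof -
  let ?R = "path_edges n \<inter> S \<times> S"
  have edge: "(x, Suc x) \<in> ?R \<and> (Suc x, x) \<in> ?R" if "a \<le> x" "Suc x < b" for x
  proof -
    have "x \<in> S" "Suc x \<in> S"
      using sub that by auto
    then show ?thesis
      using S by (auto simp: path_edges_def)
  qed
  have path: "(x, y) \<in> ?R\<^sup>* \<and> (y, x) \<in> ?R\<^sup>*" if "x \<le> y" "a \<le> x" "y < b" for x y
    using that
  proof (induction y rule: dec_induct)
    case base
    then show ?case by simp
  next
    case (step y)
    then show ?case
      using edge[of y] by (auto intro: rtrancl_into_rtrancl converse_rtrancl_into_rtrancl)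
  qed
  have reach: "w \<in> {a..<b}" if "(p, w) \<in> ?R\<^sup>*" for w
    using that
  proof (induction rule: rtrancl_induct)
    case base
    then show ?case using p .
  next
    case (step y z)
    then have z: "z \<in> S" "z = Suc y \<or> y = Suc z"
      by (auto simp: path_edges_def)
    have "z \<noteq> b"
      using z right by auto
    moreover have "a \<le> z"
      using z left[of z] step.IH by (cases "z < a") auto
    ultimately show ?case
      using z step.IH by auto
  qed
  have "(p, w) \<in> ?R\<^sup>*" if "w \<in> {a..<b}" for w
    using path[of p w] path[of w p] p that by (cases "p \<le> w") auto
  then show ?thesis
    using reach sub unfolding component_def by blast
qed

definition win_count ::
  "nat \<Rightarrow> nat strategy \<Rightarrow> nat strategy \<Rightarrow> (nat set \<times> nat) list \<Rightarrow> nat set \<Rightarrow> nat" where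
  "win_count n \<sigma> \<tau> h C = card {p \<in> C. mover_wins (path_edges n) p \<sigma> \<tau> h C}"

lemma win_count_empty [simp]: "win_count n \<sigma> \<tau> h {} = 0"
  by (simp add: win_count_def)

text \<open>
  The history after the guess does not depend on where the poison is, so on each remaining range
  the same two strategies play and every vertex there counts for exactly one of the players.
\<close>

lemma win_count_step:
  assumes bounds: "1 \<le> l" "r \<le> Suc n" and m: "\<sigma> h {l..<r} = m" "l \<le> m" "m < r"
  defines "h' \<equiv> ({l..<r}, m) # h"
  shows "win_count n \<sigma> \<tau> h {l..<r} =
    ((m - l) - win_count n \<tau> \<sigma> h' {l..<m}) + ((r - Suc m) - win_count n \<tau> \<sigma> h' {Suc m..<r})"
proof -
  let ?S = "{l..<r} - {m}"
  let ?lost = "\<lambda>C. {p \<in> C. \<not> mover_wins (path_edges n) p \<tau> \<sigma> h' C}"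
  have S: "?S \<subseteq> path_verts n"
    using bounds by (auto simp: path_verts_def)
  have lower: "component (path_edges n) ?S p = {l..<m}" if "p \<in> {l..<m}" for p
    by (rule component_of_interval[OF S _ that]) (use m in auto)
  have upper: "component (path_edges n) ?S p = {Suc m..<r}" if "p \<in> {Suc m..<r}" for p
  proof (rule component_of_interval[OF S _ that])
    show "Suc x < Suc m" if "x \<in> ?S" "x < Suc m" for x
      using that by auto
  qed (use m in auto)
  have step: "mover_wins (path_edges n) p \<sigma> \<tau> h {l..<r} \<longleftrightarrow>
      p \<noteq> m \<and> \<not> mover_wins (path_edges n) p \<tau> \<sigma> h' (component (path_edges n) ?S p)"
    if "p \<in> {l..<r}" for p
    using that m by (subst mover_wins.simps) (auto simp: h'_def)
  have split: "{p \<in> {l..<r}. mover_wins (path_edges n) p \<sigma> \<tau> h {l..<r}} =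
      ?lost {l..<m} \<union> ?lost {Suc m..<r}"
  proof (rule set_eqI)
    fix p
    consider "p \<in> {l..<m}" | "p \<in> {Suc m..<r}" | "p = m" | "p \<notin> {l..<r}"
      by fastforce
    then show "p \<in> {p \<in> {l..<r}. mover_wins (path_edges n) p \<sigma> \<tau> h {l..<r}} \<longleftrightarrow>
        p \<in> ?lost {l..<m} \<union> ?lost {Suc m..<r}"
    proof cases
      case 1
      then show ?thesis using step[of p] lower[of p] m by auto
    next
      case 2
      then show ?thesis using step[of p] upper[of p] m by auto
    next
      case 3
      then show ?thesis using step[of p] m by auto
    next
      case 4
      then show ?thesis using m by auto
    qed
  qed
  have lost: "card (?lost C) = card C - win_count n \<tau> \<sigma> h' C" if "finite C" for C
  proof -
    have "?lost C = C - {p \<in> C. mover_wins (path_edges n) p \<tau> \<sigma> h' C}"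
      by auto
    then show ?thesis
      using that by (simp add: card_Diff_subset win_count_def)
  qed
  have "win_count n \<sigma> \<tau> h {l..<r} = card (?lost {l..<m}) + card (?lost {Suc m..<r})"
    unfolding win_count_def[of n \<sigma>] split by (rule card_Un_disjoint) auto
  then show ?thesis
    by (simp only: lost finite_atLeastLessThan card_atLeastLessThan)
qed

lemma win_prob_path:
  assumes "n \<ge> 1"
  shows "win_prob (path_verts n) (path_edges n) \<sigma> \<tau> = win_count n \<sigma> \<tau> [] (path_verts n) / n"
proof -
  have V: "finite (path_verts n)" "path_verts n \<noteq> {}" "card (path_verts n) = n"
    using assms by (auto simp: path_verts_def)
  have "path_verts n \<inter> {p. mover_wins (path_edges n) p \<sigma> \<tau> [] (path_verts n)} =
      {p \<in> path_verts n. mover_wins (path_edges n) p \<sigma> \<tau> [] (path_verts n)}"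
    by auto
  then show ?thesis
    using V by (simp add: win_prob_def win_count_def measure_pmf_of_set)
qed

section \<open>Optimal strategies\<close>

definition optimal_strategy :: "nat \<Rightarrow> nat strategy \<Rightarrow> bool" where
  "optimal_strategy n \<tau> \<longleftrightarrow> legal \<tau> \<and>
     (\<forall>h l r. 1 \<le> l \<longrightarrow> l < r \<longrightarrow> r \<le> Suc n \<longrightarrow> optimal_guess l r (\<tau> h {l..<r}))"

lemma legal_guess_interval:
  fixes l r :: nat
  assumes "legal \<sigma>" "l < r"
  shows "l \<le> \<sigma> h {l..<r}" "\<sigma> h {l..<r} < r"
proof -
  have nonempty: "{l..<r} \<noteq> {}"
    using assms(2) by simp
  have "\<sigma> h {l..<r} \<in> {l..<r}"
    using assms(1)[unfolded legal_def, rule_format, OF nonempty] .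
  then show "l \<le> \<sigma> h {l..<r}" "\<sigma> h {l..<r} < r"
    by auto
qed

text \<open>
  The two bounds need each other: after one guess the players have swapped roles, so the bound
  for an optimal mover rests on the bound for an optimal replier on smaller ranges and conversely.
\<close>

lemma optimal_strategy_bounds:
  assumes \<tau>: "optimal_strategy n \<tau>" and \<sigma>: "legal \<sigma>" and "1 \<le> l" "r \<le> Suc n"
  shows "win_count n \<sigma> \<tau> h {l..<r} \<le> mover_value (r - l) \<and>
    mover_value (r - l) \<le> win_count n \<tau> \<sigma> h {l..<r}"
  using assms(3-)
proof (induction "r - l" arbitrary: l r h rule: less_induct)
  case less
  show ?case
  proof (cases "l < r")
    case False
    then show ?thesis by (simp add: mover_value_def)
  next
    case True
    have upper: "win_count n \<sigma> \<tau> h {l..<r} \<le> mover_value (r - l)"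
    proof -
      define m where "m = \<sigma> h {l..<r}"
      have m: "l \<le> m" "m < r"
        using legal_guess_interval[OF \<sigma> True] by (auto simp: m_def)
      define h' where "h' = ({l..<r}, m) # h"
      note step = win_count_step[where \<sigma> = \<sigma> and \<tau> = \<tau> and h = h,
          OF less(2,3) m_def[symmetric] m, folded h'_def]
      have "mover_value (m - l) \<le> win_count n \<tau> \<sigma> h' {l..<m}"
        "mover_value (r - Suc m) \<le> win_count n \<tau> \<sigma> h' {Suc m..<r}"
        using less(1)[of m l h'] less(1)[of r "Suc m" h'] less(2,3) m by auto
      then have "win_count n \<sigma> \<tau> h {l..<r} \<le> replier_value (m - l) + replier_value (r - Suc m)"
        unfolding step replier_value_def by (intro add_mono diff_le_mono2)
      then show ?thesis
        using guess_value_le[OF m] by simp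
    qed
    have lower: "mover_value (r - l) \<le> win_count n \<tau> \<sigma> h {l..<r}"
    proof -
      define m where "m = \<tau> h {l..<r}"
      have opt: "optimal_guess l r m"
        using \<tau> True less(2,3) by (auto simp: optimal_strategy_def m_def)
      then have m: "l \<le> m" "m < r"
        by (auto simp: optimal_guess_def)
      define h' where "h' = ({l..<r}, m) # h"
      note step = win_count_step[where \<sigma> = \<tau> and \<tau> = \<sigma> and h = h,
          OF less(2,3) m_def[symmetric] m, folded h'_def]
      have "win_count n \<sigma> \<tau> h' {l..<m} \<le> mover_value (m - l)"
        "win_count n \<sigma> \<tau> h' {Suc m..<r} \<le> mover_value (r - Suc m)"
        using less(1)[of m l h'] less(1)[of r "Suc m" h'] less(2,3) m by auto
      then have "replier_value (m - l) + replier_value (r - Suc m) \<le> win_count n \<tau> \<sigma> h {l..<r}"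
        unfolding step replier_value_def by (intro add_mono diff_le_mono2)
      then show ?thesis
        using opt by (simp add: optimal_guess_def)
    qed
    from upper lower show ?thesis ..
  qed
qed

text \<open>
  Whatever happens after the first guess, an optimal second player concedes no more than the
  value of that guess; this refutes suboptimal first guesses.
\<close>

lemma win_count_le_first_guess:
  assumes \<tau>: "optimal_strategy n \<tau>" and \<sigma>: "legal \<sigma>" and n: "1 \<le> n"
    and m: "m = \<sigma> [] {1..<Suc n}"
  shows "win_count n \<sigma> \<tau> [] {1..<Suc n} \<le> replier_value (m - 1) + replier_value (n - m)"
proof -
  have b: "1 \<le> m" "m < Suc n"
    using legal_guess_interval[OF \<sigma>, of 1 "Suc n"] n m by auto
  let ?h = "[({1..<Suc n}, m)]"
  have "mover_value (m - 1) \<le> win_count n \<tau> \<sigma> ?h {1..<m}"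
    using optimal_strategy_bounds[OF \<tau> \<sigma>, of 1 m ?h] b by simp
  moreover have "mover_value (Suc n - Suc m) \<le> win_count n \<tau> \<sigma> ?h {Suc m..<Suc n}"
    using optimal_strategy_bounds[OF \<tau> \<sigma>, of "Suc m" "Suc n" ?h] b by simp
  moreover have step: "win_count n \<sigma> \<tau> [] {1..<Suc n} =
      ((m - 1) - win_count n \<tau> \<sigma> ?h {1..<m}) +
      ((Suc n - Suc m) - win_count n \<tau> \<sigma> ?h {Suc m..<Suc n})"
    by (rule win_count_step) (use b m in simp_all)
  ultimately show ?thesis
    unfolding step replier_value_def diff_Suc_Suc by (intro add_mono diff_le_mono2)
qed

text \<open>
  Guess the second smallest vertex, or the only one; \<open>Inf\<close> is the least element for every
  nonempty set of naturals, so the strategy is legal at infinite positions too.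
\<close>

definition second_vertex :: "nat set \<Rightarrow> nat" where
  "second_vertex C = (if Suc (Inf C) \<in> C then Suc (Inf C) else Inf C)"

lemma second_vertex_optimal:
  assumes "l < r"
  shows "optimal_guess l r (second_vertex {l..<r})"
proof -
  have Inf: "Inf {l..<r} = l"
    using assms by (intro cInf_eq_minimum) auto
  show ?thesis
  proof (cases "Suc l < r")
    case True
    define d where "d = r - Suc (Suc l)"
    have r: "r - l = Suc (Suc d)"
      using True by (simp add: d_def)
    have "replier_value 1 + replier_value d = mover_value (Suc (Suc d))"
    proof -
      have "replier_value 1 + replier_value i = mover_value (Suc (1 + i))"
        if "i \<in> {0, 1, 2, 3}" for i
        using that by (elim insertE emptyE) (simp_all add: replier_value_def mover_value_def)
      from this[OF mod4_cases, of d] show ?thesis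
        using split_value_residues[of 1 d] by simp
    qed
    then show ?thesis
      using True r by (simp add: second_vertex_def Inf optimal_guess_def d_def)
  next
    case False
    then have "r = Suc l"
      using assms by simp
    then show ?thesis
      using Inf by (simp add: second_vertex_def optimal_guess_def replier_value_def mover_value_def)
  qed
qed

text \<open>Any optimal first guess extends to an optimal strategy, which
  shows both that equilibria exist and that each such guess occurs in one.\<close>

lemma optimal_strategy_with_first_guess:
  assumes "optimal_guess 1 (Suc n) m"
  shows "optimal_strategy n (\<lambda>h C. if C = {1..<Suc n} then m else second_vertex C)"
    (is "optimal_strategy n ?\<sigma>")
proof -
  have "second_vertex C \<in> C" if "C \<noteq> {}" for C
    using that Inf_nat_def1[of C] by (auto simp: second_vertex_def)
  moreover have m: "m \<in> {1..<Suc n}"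
    using assms by (auto simp: optimal_guess_def)
  ultimately have "legal ?\<sigma>"
    by (auto simp: legal_def)
  moreover have "optimal_guess l r (?\<sigma> h {l..<r})" if "1 \<le> l" "l < r" "r \<le> Suc n" for h l r
  proof (cases "{l..<r} = {1..<Suc n}")
    case True
    then have "l = 1" "r = Suc n"
      using m that by (auto simp: atLeastLessThan_eq_iff)
    then show ?thesis
      using assms by simp
  next
    case False
    then show ?thesis
      using second_vertex_optimal that by (auto simp del: atLeastLessThan_eq_iff)
  qed
  ultimately show ?thesis
    unfolding optimal_strategy_def by blast
qed

section \<open>Equilibria\<close>

lemma path_verts_interval: "path_verts n = {1..<Suc n}"
  by (auto simp: path_verts_def)

lemma optimal_strategy_win_prob:
  assumes "n \<ge> 1" "optimal_strategy n \<tau>" "legal \<sigma>"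
  shows "win_prob (path_verts n) (path_edges n) \<sigma> \<tau> \<le> mover_value n / n"
    and "mover_value n / n \<le> win_prob (path_verts n) (path_edges n) \<tau> \<sigma>"
  using optimal_strategy_bounds[OF assms(2,3), of 1 "Suc n" "[]"]
  unfolding win_prob_path[OF assms(1)] unfolding path_verts_interval by (simp_all add: divide_right_mono)

lemma optimal_strategies_optimal_play:
  assumes "n \<ge> 1" "optimal_strategy n \<sigma>" "optimal_strategy n \<tau>"
  shows "optimal_play (path_verts n) (path_edges n) \<sigma> \<tau>"
proof -
  have "legal \<sigma>" "legal \<tau>"
    using assms by (auto simp: optimal_strategy_def)
  then show ?thesis
    unfolding optimal_play_def using optimal_strategy_win_prob assms by (meson order_trans)
qed

lemma ex_optimal_strategy:
  assumes "n \<ge> 1"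
  shows "\<exists>\<tau>. optimal_strategy n \<tau>"
  using optimal_strategy_with_first_guess[OF second_vertex_optimal[of 1 "Suc n"]] assms by auto

text \<open>
  Compare each side of the equilibrium with an optimal strategy \<open>\<rho>\<close>: letting the second player
  deviate to \<open>\<rho>\<close> bounds the value from above, letting the first player do so bounds it from below.
\<close>

lemma optimal_play_win_prob:
  assumes "n \<ge> 1" "optimal_play (path_verts n) (path_edges n) \<sigma> \<tau>"
  shows "win_prob (path_verts n) (path_edges n) \<sigma> \<tau> = mover_value n / n"
proof -
  obtain \<rho> where \<rho>: "optimal_strategy n \<rho>"
    using ex_optimal_strategy assms(1) by blast
  then have "legal \<rho>"
    by (simp add: optimal_strategy_def)
  then show ?thesis
    using assms(2) optimal_strategy_win_prob[OF assms(1) \<rho>] unfolding optimal_play_def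
    by (meson order_antisym order_trans)
qed

lemma optimal_play_first_guess:
  assumes n: "n \<ge> 1" and play: "optimal_play (path_verts n) (path_edges n) \<sigma> \<tau>"
  shows "optimal_guess 1 (Suc n) (\<sigma> [] (path_verts n))"
proof -
  define m where "m = \<sigma> [] {1..<Suc n}"
  obtain \<rho> where \<rho>: "optimal_strategy n \<rho>"
    using ex_optimal_strategy n by blast
  have legal: "legal \<sigma>" "legal \<rho>"
    using play \<rho> by (auto simp: optimal_play_def optimal_strategy_def)
  have m: "1 \<le> m" "m < Suc n"
    using legal_guess_interval[OF legal(1), of 1 "Suc n"] n by (auto simp: m_def)
  \<comment> \<open>An optimal second player must not do better against \<open>\<sigma>\<close> than \<open>\<tau>\<close> does.\<close>
  have "mover_value n / n \<le> win_prob (path_verts n) (path_edges n) \<sigma> \<rho>"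
    using play legal(2) optimal_play_win_prob[OF n play] by (metis optimal_play_def)
  then have "mover_value n \<le> win_count n \<sigma> \<rho> [] {1..<Suc n}"
    using n unfolding win_prob_path[OF n] unfolding path_verts_interval by (simp add: divide_le_cancel)
  also have "\<dots> \<le> replier_value (m - 1) + replier_value (n - m)"
    by (rule win_count_le_first_guess[OF \<rho> legal(1) n m_def])
  finally have "optimal_guess 1 (Suc n) m"
    using m guess_value_le[OF m] by (simp add: optimal_guess_def)
  then show ?thesis
    by (simp add: m_def path_verts_interval)
qed

lemma optimal_first_guesses_path:
  assumes n: "n \<ge> 1"
  shows "optimal_first_guesses (path_verts n) (path_edges n) = {m. optimal_guess 1 (Suc n) m}"
proof (intro set_eqI iffI)
  fix m assume "m \<in> optimal_first_guesses (path_verts n) (path_edges n)"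
  then show "m \<in> {m. optimal_guess 1 (Suc n) m}"
    using optimal_play_first_guess[OF n] by (auto simp: optimal_first_guesses_def)
next
  fix m assume "m \<in> {m. optimal_guess 1 (Suc n) m}"
  then have \<sigma>: "optimal_strategy n (\<lambda>h C. if C = {1..<Suc n} then m else second_vertex C)"
    (is "optimal_strategy n ?\<sigma>")
    using optimal_strategy_with_first_guess by blast
  have "m = ?\<sigma> [] (path_verts n)"
    by (simp add: path_verts_interval)
  then show "m \<in> optimal_first_guesses (path_verts n) (path_edges n)"
    using optimal_strategies_optimal_play[OF n \<sigma> \<sigma>] unfolding optimal_first_guesses_def mem_Collect_eq
    by (intro exI conjI)
qed

lemma optimal_guess_path_iff:
  "optimal_guess 1 (Suc n) m \<longleftrightarrow> m \<in> {1..n} \<and>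
     replier_value (m - 1) + replier_value (n - m) = mover_value (Suc ((m - 1) + (n - m)))"
  by (auto simp: optimal_guess_def)

theorem theorem1p1:
  fixes n :: nat
  assumes "n \<ge> 1"
  shows "(\<exists>\<sigma> \<tau>. optimal_play (path_verts n) (path_edges n) \<sigma> \<tau>) \<and>
    (\<forall>\<sigma> \<tau>. optimal_play (path_verts n) (path_edges n) \<sigma> \<tau> \<longrightarrow>
      (even n \<longrightarrow> win_prob (path_verts n) (path_edges n) \<sigma> \<tau> = 1 / 2) \<and>
      (\<forall>k::nat. n = 4 * k + 1 \<longrightarrow>
        win_prob (path_verts n) (path_edges n) \<sigma> \<tau> = (2 * real k) / (4 * real k + 1)) \<and>
      (\<forall>k::nat. n = 4 * k + 3 \<longrightarrow>
        win_prob (path_verts n) (path_edges n) \<sigma> \<tau> = (2 * real k + 2) / (4 * real k + 3))) \<and>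
    (\<forall>k::nat. n = 4 * k \<longrightarrow>
      optimal_first_guesses (path_verts n) (path_edges n) =
        {m \<in> {1..n}. \<exists>k1 k2. int k1 + int k2 = int k - 1 \<and> splits_into n m (4 * k1 + 1) (4 * k2 + 2)}) \<and>
    (\<forall>k::nat. n = 4 * k + 1 \<longrightarrow>
      optimal_first_guesses (path_verts n) (path_edges n) = {1..n}) \<and>
    (\<forall>k::nat. n = 4 * k + 2 \<longrightarrow>
      optimal_first_guesses (path_verts n) (path_edges n) =
        {m \<in> {1..n}. \<exists>k1 k2. k1 + k2 = k \<and> splits_into n m (4 * k1 + 1) (4 * k2)}) \<and>
    (\<forall>k::nat. n = 4 * k + 3 \<longrightarrow>
      optimal_first_guesses (path_verts n) (path_edges n) =
        {m \<in> {1..n}. \<exists>k1 k2. k1 + k2 = k \<and> splits_into n m (4 * k1 + 1) (4 * k2 + 1)})"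
proof -
  let ?V = "path_verts n" and ?E = "path_edges n"
  have equilibrium: "\<exists>\<sigma> \<tau>. optimal_play ?V ?E \<sigma> \<tau>"
    using ex_optimal_strategy optimal_strategies_optimal_play assms by blast
  have win_probs: "(even n \<longrightarrow> win_prob ?V ?E \<sigma> \<tau> = 1 / 2) \<and>
      (\<forall>k::nat. n = 4 * k + 1 \<longrightarrow> win_prob ?V ?E \<sigma> \<tau> = (2 * real k) / (4 * real k + 1)) \<and>
      (\<forall>k::nat. n = 4 * k + 3 \<longrightarrow> win_prob ?V ?E \<sigma> \<tau> = (2 * real k + 2) / (4 * real k + 3))"
    if "optimal_play ?V ?E \<sigma> \<tau>" for \<sigma> \<tau>
  proof (intro conjI allI impI)
    note v = optimal_play_win_prob[OF assms that]
    show "win_prob ?V ?E \<sigma> \<tau> = 1 / 2" if "even n"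
      using that assms by (simp add: v mover_value_even real_of_nat_div)
    show "win_prob ?V ?E \<sigma> \<tau> = (2 * real k) / (4 * real k + 1)" if "n = 4 * k + 1" for k
    proof -
      have "mover_value n = 2 * k"
        unfolding that mover_value_add4 by (simp add: mover_value_def)
      then show ?thesis
        unfolding v by (simp add: that)
    qed
    show "win_prob ?V ?E \<sigma> \<tau> = (2 * real k + 2) / (4 * real k + 3)" if "n = 4 * k + 3" for k
    proof -
      have "mover_value n = 2 * k + 2"
        unfolding that mover_value_add4 by (simp add: mover_value_def)
      then show ?thesis
        unfolding v by (simp add: that)
    qed
  qed
  have guess: "m \<in> optimal_first_guesses ?V ?E \<longleftrightarrow> m \<in> {1..n} \<and>
      replier_value (m - 1) + replier_value (n - m) = mover_value (Suc ((m - 1) + (n - m)))" for m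
    using optimal_first_guesses_path[OF assms] optimal_guess_path_iff by auto
  have sizes: "Suc ((m - 1) + (n - m)) = n" if "m \<in> {1..n}" for m
    using that by auto
  have 0: "optimal_first_guesses ?V ?E =
      {m \<in> {1..n}. \<exists>k1 k2. int k1 + int k2 = int k - 1 \<and> splits_into n m (4 * k1 + 1) (4 * k2 + 2)}"
    if k: "n = 4 * k" for k
  proof -
    have "replier_value (m - 1) + replier_value (n - m) = mover_value (Suc ((m - 1) + (n - m))) \<longleftrightarrow>
        (\<exists>k1 k2. int k1 + int k2 = int k - 1 \<and> splits_into n m (4 * k1 + 1) (4 * k2 + 2))"
      if m: "m \<in> {1..n}" for m
      unfolding splits_into_def by (rule optimal_sizes_0[OF trans[OF sizes[OF m] k]])
    then show ?thesis
      using guess by blast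
  qed
  have 1: "optimal_first_guesses ?V ?E = {1..n}" if k: "n = 4 * k + 1" for k
    using guess optimal_sizes_1[OF trans[OF sizes k]] by blast
  have 2: "optimal_first_guesses ?V ?E =
      {m \<in> {1..n}. \<exists>k1 k2. k1 + k2 = k \<and> splits_into n m (4 * k1 + 1) (4 * k2)}"
    if k: "n = 4 * k + 2" for k
  proof -
    have "replier_value (m - 1) + replier_value (n - m) = mover_value (Suc ((m - 1) + (n - m))) \<longleftrightarrow>
        (\<exists>k1 k2. k1 + k2 = k \<and> splits_into n m (4 * k1 + 1) (4 * k2))"
      if m: "m \<in> {1..n}" for m
      unfolding splits_into_def by (rule optimal_sizes_2[OF trans[OF sizes[OF m] k]])
    then show ?thesis
      using guess by blast
  qed
  have 3: "optimal_first_guesses ?V ?E =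
      {m \<in> {1..n}. \<exists>k1 k2. k1 + k2 = k \<and> splits_into n m (4 * k1 + 1) (4 * k2 + 1)}"
    if k: "n = 4 * k + 3" for k
  proof -
    have "replier_value (m - 1) + replier_value (n - m) = mover_value (Suc ((m - 1) + (n - m))) \<longleftrightarrow>
        (\<exists>k1 k2. k1 + k2 = k \<and> splits_into n m (4 * k1 + 1) (4 * k2 + 1))"
      if m: "m \<in> {1..n}" for m
      unfolding splits_into_def by (rule optimal_sizes_3[OF trans[OF sizes[OF m] k]])
    then show ?thesis
      using guess by blast
  qed
  show ?thesis
    using equilibrium win_probs 0 1 2 3 by (intro conjI; blast)
qed

end
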